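(* Let $p,q\in\mathbb{C}^*$ with $p\neq q$. The Hom-Lie algebra $\mathfrak{sl}(2)_{p,q}$ is isomorphic (as a Hom-Lie algebra) to $\mathfrak{sl}(2)_{q/p}$.
   Context: $\mathfrak{sl}(2)_{p,q}$ is the complex Hom-Lie algebra with basis $e,f,h$, bracket and twist $$[h,e] = 2p^{-1} e, \quad [h,f] = -2qp^{-2} f, \quad [e,f] = \tfrac{p+q}{2p^2} h,$$ $$\alpha_{p,q}(e) = (1+qp^{-1})e, \quad \alpha_{p,q}(f) = qp^{-1}(1+qp^{-1}) f, \quad \alpha_{p,q}(h) = 2qp^{-1} h.$$ For $r\in\mathbb{C}^*$, $r \ne 1$, $\mathfrak{sl}(2)_{r}$ is $\mathfrak{sl}(2)_{1,r}$, i.e. the Hom-Lie algebra with basis $e,f,h$ and $$[h,e] = 2 e, \quad [h,f] = -2r f, \quad [e,f] = \tfrac{1+r}{2} h, \quad \alpha_r(e) = (1+r)e, \quad \alpha_r(f) = r(1+r) f, \quad \alpha_r(h) = 2r h.$$ A Hom-Lie algebra over $\mathbb{C}$ is a triple $(L,[\cdot,\cdot],\alpha)$ with $L$ a vector space, $[\cdot,\cdot]$ a bilinear skew-symmetric bracket on $L$ and $\alpha:L\to L$ a linear map such that $[\alpha(x),[y,z]]+[\alpha(y),[z,x]]+[\alpha(z),[x,y]]=0$ for all $x,y,z$. A morphism of Hom-Lie algebras $(L,[\cdot,\cdot],\alpha)\to(L',[\cdot,\cdot]',\alpha')$ is a linear map $\varphi$ with $[\varphi(x),\varphi(y)]'=\varphi([x,y])$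 for all $x,y$ and $\varphi\circ\alpha=\alpha'\circ\varphi$; an isomorphism is a bijective morphism. *)

theory Defs
  imports "HOL-Analysis.Analysis"
begin

record 'a hom_lie =
  scal :: "complex \<Rightarrow> 'a \<Rightarrow> 'a"
  bracket :: "'a \<Rightarrow> 'a \<Rightarrow> 'a"
  twist :: "'a \<Rightarrow> 'a"

locale hom_lie_algebra =
  vs: vector_space "scal L" for L :: "'a::ab_group_add hom_lie" +
  assumes bracket_linear_right: "\<And>x. Vector_Spaces.linear (scal L) (scal L) (\<lambda>y. bracket L x y)"
    and bracket_linear_left: "\<And>y. Vector_Spaces.linear (scal L) (scal L) (\<lambda>x. bracket L x y)"
    and bracket_skew: "\<And>x y. bracket L x y = - bracket L y x"
    and twist_linear: "Vector_Spaces.linear (scal L) (scal L) (twist L)"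
    and hom_jacobi: "\<And>x y z.
      bracket L (twist L x) (bracket L y z)
      + bracket L (twist L y) (bracket L z x)
      + bracket L (twist L z) (bracket L x y) = 0"

locale hom_lie_morphism =
  dom: hom_lie_algebra L + cod: hom_lie_algebra L'
  for L :: "'a::ab_group_add hom_lie" and L' :: "'b::ab_group_add hom_lie" +
  fixes \<phi> :: "'a \<Rightarrow> 'b"
  assumes linear: "Vector_Spaces.linear (scal L) (scal L') \<phi>"
    and map_bracket: "\<And>x y. bracket L' (\<phi> x) (\<phi> y) = \<phi> (bracket L x y)"
    and map_twist: "\<phi> \<circ> twist L = twist L' \<circ> \<phi>"

definition hom_lie_isomorphic ::
    "'a::ab_group_add hom_lie \<Rightarrow> 'b::ab_group_add hom_lie \<Rightarrow> bool" where
  "hom_lie_isomorphic L L' \<longleftrightarrow> (\<exists>\<phi>. hom_lie_morphism L L' \<phi> \<and> bij \<phi>)"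

text \<open>The underlying space is coordinatised as \<open>complex^3\<close>, with \<open>e\<close>, \<open>f\<close>, \<open>h\<close> the standard
  basis in this order.\<close>

definition sl2_e :: "complex^3" where "sl2_e = axis 1 1"
definition sl2_f :: "complex^3" where "sl2_f = axis 2 1"
definition sl2_h :: "complex^3" where "sl2_h = axis 3 1"

text \<open>The bracket is the skew-symmetric bilinear extension, and the twist the linear extension,
  of the prescribed values on the basis: the coefficients in the bracket are the \<open>2 \<times> 2\<close> minors
  of the coordinates of \<open>x\<close> and \<open>y\<close>, multiplying \<open>[h,e]\<close>, \<open>[h,f]\<close> and \<open>[e,f]\<close>.\<close>

definition sl2_pq :: "complex \<Rightarrow> complex \<Rightarrow> (complex^3) hom_lie" where
  "sl2_pq p q = \<lparr>
     scal = (*s),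
     bracket = (\<lambda>x y.
         (x $ 3 * y $ 1 - x $ 1 * y $ 3) *s ((2 * inverse p) *s sl2_e)
       + (x $ 3 * y $ 2 - x $ 2 * y $ 3) *s ((- 2 * q * inverse (p^2)) *s sl2_f)
       + (x $ 1 * y $ 2 - x $ 2 * y $ 1) *s (((p + q) / (2 * p^2)) *s sl2_h)),
     twist = (\<lambda>x.
         x $ 1 *s ((1 + q * inverse p) *s sl2_e)
       + x $ 2 *s ((q * inverse p * (1 + q * inverse p)) *s sl2_f)
       + x $ 3 *s ((2 * q * inverse p) *s sl2_h)) \<rparr>"

definition sl2_r :: "complex \<Rightarrow> (complex^3) hom_lie" where
  "sl2_r r = sl2_pq 1 r"

lemma sl2_basis:
  "vec.independent {sl2_e, sl2_f, sl2_h}" "vec.span {sl2_e, sl2_f, sl2_h} = UNIV"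
  "distinct [sl2_e, sl2_f, sl2_h]"
proof -
  have "{sl2_e, sl2_f, sl2_h} = (cart_basis :: (complex^3) set)"
    by (auto simp: cart_basis_def sl2_e_def sl2_f_def sl2_h_def) (metis exhaust_3)
  then show "vec.independent {sl2_e, sl2_f, sl2_h}" "vec.span {sl2_e, sl2_f, sl2_h} = UNIV"
    by (simp_all add: independent_cart_basis span_cart_basis)
  show "distinct [sl2_e, sl2_f, sl2_h]"
    by (simp add: sl2_e_def sl2_f_def sl2_h_def axis_eq_axis)
qed

lemma sl2_pq_relations:
  "bracket (sl2_pq p q) sl2_h sl2_e = (2 * inverse p) *s sl2_e"
  "bracket (sl2_pq p q) sl2_h sl2_f = (- 2 * q * inverse (p^2)) *s sl2_f"
  "bracket (sl2_pq p q) sl2_e sl2_f = ((p + q) / (2 * p^2)) *s sl2_h"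
  "twist (sl2_pq p q) sl2_e = (1 + q * inverse p) *s sl2_e"
  "twist (sl2_pq p q) sl2_f = (q * inverse p * (1 + q * inverse p)) *s sl2_f"
  "twist (sl2_pq p q) sl2_h = (2 * q * inverse p) *s sl2_h"
  by (simp_all add: sl2_pq_def sl2_e_def sl2_f_def sl2_h_def axis_def)

lemma sl2_r_relations:
  "bracket (sl2_r r) sl2_h sl2_e = 2 *s sl2_e"
  "bracket (sl2_r r) sl2_h sl2_f = (- 2 * r) *s sl2_f"
  "bracket (sl2_r r) sl2_e sl2_f = ((1 + r) / 2) *s sl2_h"
  "twist (sl2_r r) sl2_e = (1 + r) *s sl2_e"
  "twist (sl2_r r) sl2_f = (r * (1 + r)) *s sl2_f"
  "twist (sl2_r r) sl2_h = (2 * r) *s sl2_h"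
  by (simp_all add: sl2_r_def sl2_pq_relations)

lemma hom_lie_algebra_sl2_pq: "hom_lie_algebra (sl2_pq p q)"
proof -
  define a b c d where coeffs: "a = 2 * inverse p" "b = - 2 * q * inverse (p^2)"
    "c = (p + q) / (2 * p^2)" "d = 1 + q * inverse p"
  define d2 d3 where coeffs': "d2 = q * inverse p * d" "d3 = 2 * q * inverse p"
  have ad2: "d2 * a = - (d * b)"
    by (simp add: coeffs coeffs' power2_eq_square)
  have scal: "scal (sl2_pq p q) = (*s)"
    by (simp add: sl2_pq_def)
  have br: "bracket (sl2_pq p q) x y $ 1 = a * (x $ 3 * y $ 1 - x $ 1 * y $ 3)"
    "bracket (sl2_pq p q) x y $ 2 = b * (x $ 3 * y $ 2 - x $ 2 * y $ 3)"
    "bracket (sl2_pq p q) x y $ 3 = c * (x $ 1 * y $ 2 - x $ 2 * y $ 1)" for x y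
    by (simp_all add: sl2_pq_def sl2_e_def sl2_f_def sl2_h_def axis_def coeffs)
  have tw: "twist (sl2_pq p q) x $ 1 = d * x $ 1" "twist (sl2_pq p q) x $ 2 = d2 * x $ 2"
    "twist (sl2_pq p q) x $ 3 = d3 * x $ 3" for x
    by (simp_all add: sl2_pq_def sl2_e_def sl2_f_def sl2_h_def axis_def coeffs coeffs' algebra_simps)
  show ?thesis
  proof (intro hom_lie_algebra.intro hom_lie_algebra_axioms.intro)
    show "vector_space (scal (sl2_pq p q))"
      unfolding scal by (rule vec.vector_space_axioms)
  next
    fix x y z
    have "c * (d * x $ 1 * (b * (y $ 3 * z $ 2 - y $ 2 * z $ 3)) - d2 * x $ 2 * (a * (y $ 3 * z $ 1 - y $ 1 * z $ 3))) =
       (c * (d * b)) * (x $ 1 * (y $ 3 * z $ 2 - y $ 2 * z $ 3) + x $ 2 * (y $ 3 * z $ 1 - y $ 1 * z $ 3))"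
      for x y z :: "complex^3"
      using ad2 by algebra
    note third = this
    show "bracket (sl2_pq p q) (twist (sl2_pq p q) x) (bracket (sl2_pq p q) y z)
        + bracket (sl2_pq p q) (twist (sl2_pq p q) y) (bracket (sl2_pq p q) z x)
        + bracket (sl2_pq p q) (twist (sl2_pq p q) z) (bracket (sl2_pq p q) x y) = 0"
      by (simp add: vec_eq_iff forall_3 br tw third) (simp add: algebra_simps)
  qed (auto simp: scal Vector_Spaces.linear_iff vec.vector_space_axioms vec_eq_iff forall_3 br tw
      algebra_simps)
qed

end

theory Submission
  imports Defs
begin

text \<open>The twist depends only on \<open>q / p\<close>, and the bracket of \<open>sl(2)\<^bsub>p,q\<^esub>\<close> is \<open>1 / p\<close> times
  that of \<open>sl(2)\<^bsub>q/p\<^esub>\<close>, so multiplication by \<open>1 / p\<close> is an isomorphism.\<close>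

lemma scal_sl2_pq: "scal (sl2_pq p q) = (*s)"
  by (simp add: sl2_pq_def)

lemma twist_sl2_pq_eq: "twist (sl2_pq p q) = twist (sl2_r (q / p))"
  by (simp only: sl2_r_def sl2_pq_def hom_lie.simps divide_inverse inverse_1 mult_1_right mult.assoc)

text \<open>Each structure constant for \<open>(p, q)\<close> is \<open>inverse p\<close> times the
  one for \<open>(1, q / p)\<close>, for instance
  \<open>(p + q) / (2 * p^2) = inverse p * ((1 + q / p) / 2)\<close>.\<close>

lemma bracket_sl2_pq_eq:
  "bracket (sl2_pq p q) x y = inverse p *s bracket (sl2_r (q / p)) x y" if "p \<noteq> 0"
proof -
  \<comment> \<open>The free factor \<open>c\<close> stands for a minor of the coordinates of
    \<open>x\<close> and \<open>y\<close>, so that the equations match the products formed by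
    \<open>vector_smult_assoc\<close>.\<close>
  have coeffs: "c * (2 * inverse p) = inverse p * (c * 2)"
    "c * (- 2 * q * inverse (p\<^sup>2)) = inverse p * (c * (- 2 * (q / p)))"
    "c * ((p + q) / (2 * p\<^sup>2)) = inverse p * (c * ((1 + q / p) / 2))" for c
    using that by (simp_all add: divide_simps power2_eq_square)
  show ?thesis
    by (simp only: sl2_r_def sl2_pq_def hom_lie.simps vec.scale_right_distrib vector_smult_assoc
        coeffs inverse_1 power_one mult_1_right)
qed

theorem proposition3p8:
  fixes p q :: complex
  assumes "p \<noteq> 0" and "q \<noteq> 0" and "p \<noteq> q"
  shows "hom_lie_isomorphic (sl2_pq p q) (sl2_r (q / p))"
proof -
  let ?L = "sl2_pq p q" and ?L' = "sl2_r (q / p)"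
  let ?\<phi> = "\<lambda>x :: complex^3. inverse p *s x"
  have scal': "scal ?L' = (*s)"
    by (simp add: sl2_r_def scal_sl2_pq)
  interpret L': hom_lie_algebra ?L'
    unfolding sl2_r_def by (rule hom_lie_algebra_sl2_pq)
  have bracket_scale: "bracket ?L' (c *s u) v = c *s bracket ?L' u v"
      "bracket ?L' u (c *s v) = c *s bracket ?L' u v" for c u v
    using L'.bracket_linear_left[of v] L'.bracket_linear_right[of u]
    unfolding Vector_Spaces.linear_iff scal' by blast+
  have twist_scale: "twist ?L' (c *s u) = c *s twist ?L' u" for c u
    using L'.twist_linear unfolding Vector_Spaces.linear_iff scal' by blast
  have "hom_lie_morphism ?L ?L' ?\<phi>"
  proof (intro hom_lie_morphism.intro hom_lie_morphism_axioms.intro)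
    show "hom_lie_algebra ?L"
      by (rule hom_lie_algebra_sl2_pq)
    show "hom_lie_algebra ?L'"
      by (rule L'.hom_lie_algebra_axioms)
    show "Vector_Spaces.linear (scal ?L) (scal ?L') ?\<phi>"
      unfolding scal_sl2_pq scal' by (rule vec.linear_scale_self)
    \<comment> \<open>Both sides are \<open>inverse p\<close> squared times the target bracket: on
      the left one factor comes from each argument, on the right one from the map and one from
      comparing the brackets.\<close>
    show "bracket ?L' (?\<phi> x) (?\<phi> y) = ?\<phi> (bracket ?L x y)" for x y
      by (simp only: bracket_scale bracket_sl2_pq_eq[OF assms(1)])
    \<comment> \<open>The two twists are the same linear map, which commutes with scalars.\<close>
    show "?\<phi> \<circ> twist ?L = twist ?L' \<circ> ?\<phi>"
      by (simp add: fun_eq_iff twist_sl2_pq_eq twist_scale)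
  qed
  moreover have "bij ?\<phi>"
    by (rule o_bij[where g = "\<lambda>x. p *s x"]) (simp_all add: fun_eq_iff assms(1))
  ultimately show ?thesis
    unfolding hom_lie_isomorphic_def by (intro exI conjI)
qed

end
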